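(* Let $n\geq 2$ and let $f\in C_0(\mathbb{Z}^n)$ be nonnegative. For $i=1,\dots,n$ define $f_i:\mathbb{Z}^{n-1}\to\mathbb{R}$ by $$f_i(z_1,\dots,\widehat{z_i},\dots,z_n)=\max_{z_i\in\mathbb{Z}}f(z_1,\dots,z_i,\dots,z_n).$$ Then $$\|f\|_{\frac{n}{n-1}}\leq\left(\prod_{i=1}^n\|f_i\|_1\right)^{\frac1n}.$$ Moreover, equality holds if and only if $f=\lambda\cdot\chi_A$ for some $\lambda>0$ and some subset $A\subset\mathbb{Z}^n$ with $A=\prod_{i=1}^n\pi_i(A)$.
   Context: $C_0(\mathbb{Z}^m)$ denotes the space of real-valued functions on $\mathbb{Z}^m$ with finite support. For $p>0$ and $g\in C_0(\mathbb{Z}^m)$, $\|g\|_p:=\left(\sum_{z\in\mathbb{Z}^m}|g(z)|^p\right)^{1/p}$; here $\|f\|_{\frac{n}{n-1}}$ is taken on $\mathbb{Z}^n$ and $\|f_i\|_1$ on $\mathbb{Z}^{n-1}$. The notation $\widehat{z_i}$ means that $z_i$ is omitted. $\pi_i:\mathbb{Z}^n\to\mathbb{Z}$ is the projection $(z_1,\dots,z_n)\mapsto z_i$, and $\chi_A$ is the indicator function of $A$. The set $A$ is allowed to be empty (corresponding to $f\equiv 0$). *)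

theory Defs
  imports "HOL-Analysis.Infinite_Sum" "HOL-Library.FuncSet" "HOL-Library.Indicator_Function"
begin

text \<open>
  The lattice of integer points with coordinates indexed by \<open>I\<close>: \<open>lattice {1..n}\<close> is
  $\mathbb{Z}^n$, and \<open>lattice ({1..n} - {i})\<close> is the copy of $\mathbb{Z}^{n-1}$ whose points are
  the tuples $(z_1,\dots,\widehat{z_i},\dots,z_n)$.
  A real function on the lattice is a function on \<open>nat \<Rightarrow> int\<close> whose values off the lattice are
  irrelevant: everything below only looks at its values on the lattice.
\<close>

definition lattice :: "nat set \<Rightarrow> (nat \<Rightarrow> int) set" where
  "lattice I = (I \<rightarrow>\<^sub>E UNIV)"

definition C0 :: "(nat \<Rightarrow> int) set \<Rightarrow> ((nat \<Rightarrow> int) \<Rightarrow> real) set" where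
  "C0 X = {g. finite {z \<in> X. g z \<noteq> 0}}"

definition lp_norm :: "(nat \<Rightarrow> int) set \<Rightarrow> real \<Rightarrow> ((nat \<Rightarrow> int) \<Rightarrow> real) \<Rightarrow> real" where
  "lp_norm X p g = (\<Sum>\<^sub>\<infinity>z\<in>X. \<bar>g z\<bar> powr p) powr (1 / p)"

text \<open>
  For \<open>w\<close> in \<open>lattice ({1..n} - {i})\<close>, the update \<open>w(i := t)\<close> is the point of \<open>lattice {1..n}\<close>
  obtained by inserting \<open>t\<close> as the missing coordinate. For \<open>f\<close> of finite support the set
  of values is finite, so that \<open>Max\<close> is a genuine maximum.
\<close>

definition fibre_max :: "nat \<Rightarrow> ((nat \<Rightarrow> int) \<Rightarrow> real) \<Rightarrow> (nat \<Rightarrow> int) \<Rightarrow> real" where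
  "fibre_max i f w = Max (range (\<lambda>t. f (w(i := t))))"

definition coord :: "nat \<Rightarrow> (nat \<Rightarrow> int) \<Rightarrow> int" where
  "coord i z = z i"

end

(* Slice f along the last coordinate k into functions f^t of m = n - 1 coordinates. Then
   f^(1 + 1/m) <= f_k^(1/m) * f^t pointwise on each slice. By Hoelder and induction,
   the sum of f_k^(1/m) * f^t over the slice is at most
   ||f_k||_1^(1/m) * (prod over i of ||(f^t)_i||_1)^(1/m), and a second application of Hoelder,
   now over t, turns the slice norms into the norms ||f_i||_1.

   For equality, the induction gives that each nonzero slice is constant on a box, the first
   Hoelder step forces f_k to vanish off that box, and the pointwise bound forces f^t = f_k on it.
   Hence all nonzero slices coincide with f_k. The equality case of the second Hoelder step is
   never needed. *)
theory Submission
  imports Defs "HOL-Analysis.Convex"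
begin

section \<open>Hoelder's inequality for finite sums\<close>

text \<open>Divide \<open>a\<close> and \<open>b\<close> by their totals and apply Young's
  inequality at each \<open>x\<close>. The bounds add up to
  \<open>\<alpha> + \<beta> = 1\<close>.\<close>

lemma Holder_sum2:
  fixes a b :: "'a \<Rightarrow> real"
  assumes "finite A" "0 \<le> \<alpha>" "0 \<le> \<beta>" "\<alpha> + \<beta> = 1"
    and a: "\<And>x. x \<in> A \<Longrightarrow> 0 \<le> a x" and b: "\<And>x. x \<in> A \<Longrightarrow> 0 \<le> b x"
  shows "(\<Sum>x\<in>A. a x powr \<alpha> * b x powr \<beta>) \<le> sum a A powr \<alpha> * sum b A powr \<beta>"
proof (cases "sum a A = 0 \<or> sum b A = 0")
  case True
  \<comment> \<open>This includes exponent 0, because \<open>0 powr 0 = 0\<close>.\<close>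
  then have "(\<Sum>x\<in>A. a x powr \<alpha> * b x powr \<beta>) = 0"
    using assms(1) a b by (intro sum.neutral) (auto simp: sum_nonneg_eq_0_iff)
  with True show ?thesis by auto
next
  case False
  define s t where "s = sum a A" and "t = sum b A"
  have pos: "0 < s" "0 < t"
    using False a b unfolding s_def t_def by (auto simp: less_le intro!: sum_nonneg)
  have "a x powr \<alpha> * b x powr \<beta> \<le> (\<alpha> * (a x / s) + \<beta> * (b x / t)) * (s powr \<alpha> * t powr \<beta>)"
    if "x \<in> A" for x
  proof (cases "a x = 0 \<or> b x = 0")
    case True
    then have "a x powr \<alpha> * b x powr \<beta> = 0"
      by auto
    moreover have "0 \<le> (\<alpha> * (a x / s) + \<beta> * (b x / t)) * (s powr \<alpha> * t powr \<beta>)"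
      using pos a[OF that] b[OF that] assms(2,3) by auto
    ultimately show ?thesis by linarith
  next
    case False
    then have "0 < a x / s" "0 < b x / t"
      using a[OF that] b[OF that] pos by auto
    from Youngs_inequality_0[OF assms(2-4) this]
    have "(a x / s) powr \<alpha> * (b x / t) powr \<beta> * (s powr \<alpha> * t powr \<beta>)
        \<le> (\<alpha> * (a x / s) + \<beta> * (b x / t)) * (s powr \<alpha> * t powr \<beta>)"
      by (intro mult_right_mono) auto
    moreover have "(a x / s) powr \<alpha> * (b x / t) powr \<beta> * (s powr \<alpha> * t powr \<beta>)
        = a x powr \<alpha> * b x powr \<beta>"
      using pos by (simp add: powr_divide)
    ultimately show ?thesis by simp
  qed
  then have "(\<Sum>x\<in>A. a x powr \<alpha> * b x powr \<beta>)
      \<le> (\<Sum>x\<in>A. (\<alpha> * (a x / s) + \<beta> * (b x / t)) * (s powr \<alpha> * t powr \<beta>))"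
    by (rule sum_mono)
  also have "\<dots> = (\<Sum>x\<in>A. \<alpha> * (a x / s) + \<beta> * (b x / t)) * (s powr \<alpha> * t powr \<beta>)"
    by (simp only: sum_distrib_right)
  also have "(\<Sum>x\<in>A. \<alpha> * (a x / s) + \<beta> * (b x / t)) = \<alpha> * (s / s) + \<beta> * (t / t)"
    by (simp only: sum.distrib sum_distrib_left[symmetric] sum_divide_distrib[symmetric] s_def t_def)
  also have "\<dots> = 1" using pos assms(4) by simp
  finally show ?thesis unfolding s_def t_def by simp
qed

text \<open>The same normalisation, with the arithmetic-geometric mean inequality over
  \<open>I\<close> in place of Young's inequality. This is the Hoelder step over the slices.\<close>

lemma Holder_sum_prod:
  fixes a :: "'i \<Rightarrow> 'a \<Rightarrow> real"
  assumes "finite A" "finite I" "I \<noteq> {}"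
    and a: "\<And>i x. i \<in> I \<Longrightarrow> x \<in> A \<Longrightarrow> 0 \<le> a i x"
  shows "(\<Sum>x\<in>A. (\<Prod>i\<in>I. a i x) powr (1 / card I)) \<le> (\<Prod>i\<in>I. sum (a i) A) powr (1 / card I)"
proof (cases "\<exists>i\<in>I. sum (a i) A = 0")
  case True
  then obtain i where i: "i \<in> I" "sum (a i) A = 0" by blast
  then have "\<forall>x\<in>A. a i x = 0"
    using assms(1) a by (simp add: sum_nonneg_eq_0_iff)
  then have "\<forall>x\<in>A. (\<Prod>i\<in>I. a i x) = 0"
    using i assms(2) by auto
  then show ?thesis by simp
next
  case False
  define s where "s i = sum (a i) A" for i
  define P where "P = (\<Prod>i\<in>I. s i) powr (1 / card I)"
  have pos: "0 < s i" if "i \<in> I" for i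
    using False that a unfolding s_def by (auto simp: less_le intro!: sum_nonneg)
  have "(\<Prod>i\<in>I. a i x) powr (1 / card I) \<le> (\<Sum>i\<in>I. a i x / s i / card I) * P" if "x \<in> A" for x
  proof -
    have "(\<Prod>i\<in>I. a i x / s i) powr (1 / card I) * P \<le> (\<Sum>i\<in>I. a i x / s i / card I) * P"
    proof (rule mult_right_mono)
      show "(\<Prod>i\<in>I. a i x / s i) powr (1 / card I) \<le> (\<Sum>i\<in>I. a i x / s i / card I)"
        using assms(2,3) a that pos by (intro arith_geom_mean) (auto simp: less_imp_le)
    qed (simp add: P_def)
    moreover have "(\<Prod>i\<in>I. a i x / s i) powr (1 / card I) * P = (\<Prod>i\<in>I. a i x) powr (1 / card I)"
    proof -
      have "(\<Prod>i\<in>I. s i) > 0" using pos by (intro prod_pos) auto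
      then show ?thesis
        by (simp add: P_def prod_dividef powr_divide)
    qed
    ultimately show ?thesis by simp
  qed
  then have "(\<Sum>x\<in>A. (\<Prod>i\<in>I. a i x) powr (1 / card I)) \<le> (\<Sum>x\<in>A. (\<Sum>i\<in>I. a i x / s i / card I) * P)"
    by (rule sum_mono)
  also have "\<dots> = (\<Sum>x\<in>A. \<Sum>i\<in>I. a i x / s i / card I) * P"
    by (simp only: sum_distrib_right)
  also have "(\<Sum>x\<in>A. \<Sum>i\<in>I. a i x / s i / card I) = (\<Sum>i\<in>I. \<Sum>x\<in>A. a i x / s i / card I)"
    by (rule sum.swap)
  also have "\<dots> = (\<Sum>i\<in>I. s i / s i / card I)"
    by (simp only: sum_divide_distrib[symmetric] s_def)
  also have "\<dots> = (\<Sum>i\<in>I. 1 / card I)"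
    using pos by (intro sum.cong) (auto simp: less_le)
  also have "\<dots> = 1" using assms(2,3) by simp
  finally show ?thesis by (simp add: P_def s_def)
qed

section \<open>Finitely supported functions, slices and fibre maxima\<close>

text \<open>One set \<open>S\<close> serves all coordinates, so slicing or dropping a coordinate
  changes only \<open>I\<close>.\<close>

definition cube :: "int set \<Rightarrow> nat set \<Rightarrow> (nat \<Rightarrow> int) set" where
  "cube S I = (I \<rightarrow>\<^sub>E S)"

text \<open>The conditions range over the whole lattice because \<open>fibre_max\<close> looks at
  all integers, not only at those in \<open>S\<close>.\<close>

definition nonneg_in_cube :: "int set \<Rightarrow> nat set \<Rightarrow> ((nat \<Rightarrow> int) \<Rightarrow> real) \<Rightarrow> bool" where
  "nonneg_in_cube S I f \<longleftrightarrow>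
     (\<forall>z\<in>lattice I. 0 \<le> f z) \<and> (\<forall>z\<in>lattice I - cube S I. f z = 0)"

text \<open>This is the norm of \<open>f_i\<close> in the theorem, as a finite sum;
  \<open>lp_norm_fibre_max\<close> identifies the two.\<close>

definition face_sum :: "int set \<Rightarrow> nat set \<Rightarrow> nat \<Rightarrow> ((nat \<Rightarrow> int) \<Rightarrow> real) \<Rightarrow> real" where
  "face_sum S I i f = (\<Sum>w\<in>cube S (I - {i}). fibre_max i f w)"

lemma cube_subset_lattice: "cube S I \<subseteq> lattice I"
  by (auto simp: cube_def lattice_def PiE_iff)

lemma finite_cube: "finite S \<Longrightarrow> finite I \<Longrightarrow> finite (cube S I)"
  by (simp add: cube_def finite_PiE)

lemma sum_cube_insert:
  assumes "k \<notin> I"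
  shows "(\<Sum>z\<in>cube S (insert k I). h z) = (\<Sum>t\<in>S. \<Sum>w\<in>cube S I. h (w(k := t)))"
  unfolding cube_def PiE_insert_eq
  by (subst sum.reindex[OF inj_combinator[OF assms]]) (simp add: sum.cartesian_product case_prod_unfold)

lemma upd_in_lattice: "i \<in> I \<Longrightarrow> w \<in> lattice (I - {i}) \<Longrightarrow> w(i := t) \<in> lattice I"
  by (auto simp: lattice_def PiE_iff extensional_def)

lemma upd_in_cube_iff:
  assumes "i \<in> I" "w \<in> lattice (I - {i})"
  shows "w(i := t) \<in> cube S I \<longleftrightarrow> t \<in> S \<and> w \<in> cube S (I - {i})"
  using assms by (auto simp: cube_def lattice_def PiE_iff extensional_def)

text \<open>Any \<open>t\<close> outside \<open>S\<close> contributes the value 0. Finiteness is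
  what makes \<open>Max\<close> a genuine maximum below.\<close>

lemma fibre_max_finite:
  assumes "finite S" "nonneg_in_cube S I f" "i \<in> I" "w \<in> lattice (I - {i})"
  shows "finite (range (\<lambda>t. f (w(i := t))))"
proof (rule finite_subset)
  show "range (\<lambda>t. f (w(i := t))) \<subseteq> insert 0 ((\<lambda>t. f (w(i := t))) ` S)"
    using assms(2) upd_in_lattice[OF assms(3,4)] upd_in_cube_iff[OF assms(3,4)]
    by (auto simp: nonneg_in_cube_def)
qed (use assms in auto)

lemma fibre_max_ge:
  assumes "finite S" "nonneg_in_cube S I f" "i \<in> I" "w \<in> lattice (I - {i})"
  shows "f (w(i := t)) \<le> fibre_max i f w"
  unfolding fibre_max_def by (rule Max_ge[OF fibre_max_finite[OF assms]]) auto

lemma fibre_max_attained: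
  assumes "finite S" "nonneg_in_cube S I f" "i \<in> I" "w \<in> lattice (I - {i})"
  obtains t where "fibre_max i f w = f (w(i := t))"
  using Max_in[OF fibre_max_finite[OF assms]] unfolding fibre_max_def by auto

lemma fibre_max_nonneg:
  assumes "finite S" "nonneg_in_cube S I f" "i \<in> I" "w \<in> lattice (I - {i})"
  shows "0 \<le> fibre_max i f w"
  using fibre_max_attained[OF assms] assms(2) upd_in_lattice[OF assms(3,4)]
  by (metis nonneg_in_cube_def)

lemma fibre_max_outside:
  assumes "finite S" "nonneg_in_cube S I f" "i \<in> I" "w \<in> lattice (I - {i}) - cube S (I - {i})"
  shows "fibre_max i f w = 0"
proof -
  have w: "w \<in> lattice (I - {i})" using assms(4) by blast
  obtain t where "fibre_max i f w = f (w(i := t))"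
    using fibre_max_attained[OF assms(1-3) w] .
  moreover have "w(i := t) \<in> lattice I - cube S I"
    using upd_in_lattice[OF assms(3) w] upd_in_cube_iff[OF assms(3) w] assms(4) by blast
  ultimately show ?thesis using assms(2) by (simp add: nonneg_in_cube_def)
qed

lemma face_sum_nonneg:
  assumes "finite S" "nonneg_in_cube S I f" "i \<in> I"
  shows "0 \<le> face_sum S I i f"
  unfolding face_sum_def
  using fibre_max_nonneg[OF assms] cube_subset_lattice by (intro sum_nonneg) blast

lemma nonneg_in_cube_slice:
  assumes "nonneg_in_cube S (insert k I) f" "k \<notin> I"
  shows "nonneg_in_cube S I (\<lambda>w. f (w(k := t)))"
proof -
  have "insert k I - {k} = I" using assms(2) by blast
  then show ?thesis
    using assms(1) upd_in_lattice[of k "insert k I"] upd_in_cube_iff[of k "insert k I"]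
    by (auto simp: nonneg_in_cube_def)
qed

lemma fibre_max_slice:
  "i \<noteq> k \<Longrightarrow> fibre_max i (\<lambda>w. f (w(k := t))) w = fibre_max i f (w(k := t))"
  unfolding fibre_max_def by (simp add: fun_upd_twist)

text \<open>As \<open>i \<noteq> k\<close>, the face without coordinate \<open>i\<close> still
  contains coordinate \<open>k\<close> and can be cut along it, and maximising over \<open>i\<close>
  commutes with fixing \<open>k\<close>.\<close>

lemma face_sum_slice:
  assumes "k \<notin> I" "i \<in> I"
  shows "face_sum S (insert k I) i f = (\<Sum>t\<in>S. face_sum S I i (\<lambda>w. f (w(k := t))))"
proof -
  have "insert k I - {i} = insert k (I - {i})" "i \<noteq> k" using assms by auto
  then show ?thesis
    using assms(1) by (simp add: face_sum_def sum_cube_insert fibre_max_slice)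
qed

section \<open>The inequality on a finite cube\<close>

text \<open>The factors \<open>X i\<close> may be empty, so for nonempty \<open>I\<close> the zero
  function counts as well. Only the part of \<open>X i\<close> inside \<open>S\<close>
  matters.\<close>

definition box_function :: "int set \<Rightarrow> nat set \<Rightarrow> ((nat \<Rightarrow> int) \<Rightarrow> real) \<Rightarrow> bool" where
  "box_function S I f \<longleftrightarrow> (\<exists>c>0. \<exists>X. \<forall>z\<in>cube S I. f z = c * indicator (Pi\<^sub>E I X) z)"

text \<open>With n = \<open>card I\<close>, this is the inequality of the theorem raised to the
  power n/(n-1), together with the direction from equality to boxes.\<close>

definition max_ineq :: "int set \<Rightarrow> nat set \<Rightarrow> bool" where
  "max_ineq S I \<longleftrightarrow> (\<forall>f. nonneg_in_cube S I f \<longrightarrow>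
     (\<Sum>z\<in>cube S I. f z powr (card I / (real (card I) - 1)))
       \<le> (\<Prod>i\<in>I. face_sum S I i f) powr (1 / (real (card I) - 1)) \<and>
     ((\<Sum>z\<in>cube S I. f z powr (card I / (real (card I) - 1)))
       = (\<Prod>i\<in>I. face_sum S I i f) powr (1 / (real (card I) - 1)) \<longrightarrow> box_function S I f))"

text \<open>
  For two or more coordinates this follows from \<open>max_ineq\<close> by Hoelder's inequality, but it also
  makes sense for a single coordinate, where the exponent in \<open>max_ineq\<close> is infinite.
\<close>

definition weighted_max_ineq :: "int set \<Rightarrow> nat set \<Rightarrow> bool" where
  "weighted_max_ineq S I \<longleftrightarrow> (\<forall>f g. nonneg_in_cube S I f \<longrightarrow>
     (\<forall>z\<in>cube S I. 0 \<le> g z \<and> (0 < f z \<longrightarrow> 0 < g z)) \<longrightarrow>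
     (\<Sum>z\<in>cube S I. g z powr (1 / card I) * f z)
       \<le> sum g (cube S I) powr (1 / card I) * (\<Prod>i\<in>I. face_sum S I i f) powr (1 / card I) \<and>
     ((\<Sum>z\<in>cube S I. g z powr (1 / card I) * f z)
       = sum g (cube S I) powr (1 / card I) * (\<Prod>i\<in>I. face_sum S I i f) powr (1 / card I) \<longrightarrow>
       (\<forall>z\<in>cube S I. f z = 0) \<or>
       box_function S I f \<and> (\<forall>z\<in>cube S I. f z = 0 \<longrightarrow> g z = 0)))"

section \<open>Induction on the number of coordinates\<close>

text \<open>The only face value is an upper bound \<open>c\<close> of \<open>f\<close>, and the
  claim is that the sum of \<open>g * f\<close> is at most that of \<open>g * c\<close>. Equality
  forces \<open>f = c\<close> wherever \<open>g\<close> is positive.\<close>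

lemma weighted_max_ineq_singleton:
  assumes "finite S"
  shows "weighted_max_ineq S {j}"
  unfolding weighted_max_ineq_def
proof (intro allI impI)
  fix f g :: "(nat \<Rightarrow> int) \<Rightarrow> real"
  assume f: "nonneg_in_cube S {j} f"
    and g: "\<forall>z\<in>cube S {j}. 0 \<le> g z \<and> (0 < f z \<longrightarrow> 0 < g z)"
  \<comment> \<open>The empty tuple, the only point of the lattice without coordinates.\<close>
  define o' where "o' = (\<lambda>_::nat. undefined :: int)"
  define c where "c = fibre_max j f o'"
  have o': "o' \<in> lattice ({j} - {j})" by (simp add: o'_def lattice_def)
  have N: "face_sum S {j} j f = c"
    by (simp add: face_sum_def cube_def c_def o'_def)
  have z_eq: "z = o'(j := z j)" if "z \<in> cube S {j}" for z
    using that by (auto simp: o'_def cube_def PiE_iff extensional_def)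
  have le: "f z \<le> c" if "z \<in> cube S {j}" for z
    using fibre_max_ge[OF assms f _ o', of "z j"] z_eq[OF that] by (simp add: c_def)
  have le': "g z * f z \<le> g z * c" if "z \<in> cube S {j}" for z
    using le g that by (intro mult_left_mono) auto
  have f0: "0 \<le> f z" if "z \<in> cube S {j}" for z
    using f that cube_subset_lattice by (auto simp: nonneg_in_cube_def)
  have c0: "0 \<le> c"
    unfolding c_def by (rule fibre_max_nonneg[OF assms f _ o']) simp
  have L: "(\<Sum>z\<in>cube S {j}. g z powr (1 / card {j}) * f z) = (\<Sum>z\<in>cube S {j}. g z * f z)"
    using g by (intro sum.cong) auto
  have R: "sum g (cube S {j}) powr (1 / card {j}) * (\<Prod>i\<in>{j}. face_sum S {j} i f) powr (1 / card {j})
      = (\<Sum>z\<in>cube S {j}. g z * c)"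
    using g c0 N by (simp add: sum_nonneg sum_distrib_right)
  show "(\<Sum>z\<in>cube S {j}. g z powr (1 / card {j}) * f z)
       \<le> sum g (cube S {j}) powr (1 / card {j}) * (\<Prod>i\<in>{j}. face_sum S {j} i f) powr (1 / card {j}) \<and>
     ((\<Sum>z\<in>cube S {j}. g z powr (1 / card {j}) * f z)
       = sum g (cube S {j}) powr (1 / card {j}) * (\<Prod>i\<in>{j}. face_sum S {j} i f) powr (1 / card {j}) \<longrightarrow>
       (\<forall>z\<in>cube S {j}. f z = 0) \<or>
       box_function S {j} f \<and> (\<forall>z\<in>cube S {j}. f z = 0 \<longrightarrow> g z = 0))"
    unfolding L R
  proof (intro conjI impI)
    show "(\<Sum>z\<in>cube S {j}. g z * f z) \<le> (\<Sum>z\<in>cube S {j}. g z * c)"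
      using le' by (rule sum_mono)
    assume eq: "(\<Sum>z\<in>cube S {j}. g z * f z) = (\<Sum>z\<in>cube S {j}. g z * c)"
    have eq': "g z * f z = g z * c" if "z \<in> cube S {j}" for z
      by (rule sum_mono_inv[OF eq le' that]) (use assms in \<open>auto intro: finite_cube\<close>)
    show "(\<forall>z\<in>cube S {j}. f z = 0) \<or>
       box_function S {j} f \<and> (\<forall>z\<in>cube S {j}. f z = 0 \<longrightarrow> g z = 0)"
    proof (cases "c = 0")
      case True
      then show ?thesis using le f0 by (auto intro: antisym)
    next
      case False
      \<comment> \<open>The support of \<open>f\<close> in its single coordinate. There
        \<open>g\<close> is positive by hypothesis, so equality gives \<open>f = c\<close>.\<close>
      define X where "X = (\<lambda>_::nat. {t. 0 < f (o'(j := t))})"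
      have "f z = c * indicator (Pi\<^sub>E {j} X) z" if z: "z \<in> cube S {j}" for z
      proof -
        have "z \<in> Pi\<^sub>E {j} X \<longleftrightarrow> 0 < f z"
          using z_eq[OF z] z by (auto simp: X_def cube_def PiE_iff)
        moreover have "0 < f z \<Longrightarrow> f z = c"
          using eq'[OF z] g z by auto
        ultimately show ?thesis using f0[OF z] by (auto simp: indicator_def)
      qed
      then have "box_function S {j} f"
        using False c0 unfolding box_function_def by (intro exI[of _ c] conjI exI[of _ X]) auto
      moreover have "\<forall>z\<in>cube S {j}. f z = 0 \<longrightarrow> g z = 0"
        using eq' False by auto
      ultimately show ?thesis by blast
    qed
  qed
qed

text \<open>Slice by slice, \<open>L t \<le> M t \<le> R t\<close>: first the pointwise bound by
  \<open>g\<close>, then \<open>Q\<close> with weight \<open>g\<close>. Hoelder over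
  \<open>t\<close> bounds the sum of \<open>R t\<close>.\<close>

lemma max_ineq_insert:
  assumes "finite S" "finite I" "I \<noteq> {}" "k \<notin> I" and Q: "weighted_max_ineq S I"
  shows "max_ineq S (insert k I)"
  unfolding max_ineq_def
proof (intro allI impI)
  fix f :: "(nat \<Rightarrow> int) \<Rightarrow> real"
  let ?J = "insert k I"
  assume f: "nonneg_in_cube S ?J f"
  define m where "m = card I"
  have m: "0 < m" "card ?J = Suc m" using assms by (auto simp: m_def card_gt_0_iff)
  define g where "g = fibre_max k f"
  define fs where "fs t = (\<lambda>w. f (w(k := t)))" for t
  have J: "?J - {k} = I" using assms(4) by blast
  have latt: "w \<in> lattice (?J - {k})" if "w \<in> cube S I" for w
    using that cube_subset_lattice by (auto simp: J)
  have le: "fs t w \<le> g w" if "w \<in> cube S I" for t w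
    unfolding fs_def g_def by (rule fibre_max_ge[OF assms(1) f _ latt[OF that]]) simp
  have fs0: "0 \<le> fs t w" if "w \<in> cube S I" for t w
    using f upd_in_lattice[OF _ latt[OF that], of t] by (auto simp: fs_def nonneg_in_cube_def)
  have g0: "\<forall>w\<in>cube S I. 0 \<le> g w \<and> (0 < fs t w \<longrightarrow> 0 < g w)" for t
    using le fs0 by (meson order_trans less_le_trans)
  have nn: "nonneg_in_cube S I (fs t)" for t
    unfolding fs_def by (rule nonneg_in_cube_slice[OF f assms(4)])
  define G where "G = sum g (cube S I)"
  have G: "face_sum S ?J k f = G" by (simp add: face_sum_def J G_def g_def)
  define L where "L t = (\<Sum>w\<in>cube S I. fs t w powr (1 + 1 / m))" for t
  define M where "M t = (\<Sum>w\<in>cube S I. g w powr (1 / m) * fs t w)" for t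
  define R where "R t = G powr (1 / m) * (\<Prod>i\<in>I. face_sum S I i (fs t)) powr (1 / m)" for t
  \<comment> \<open>With \<open>m + 1\<close> coordinates the exponent is (m+1)/m = 1 + 1/m.\<close>
  have lhs: "(\<Sum>z\<in>cube S ?J. f z powr (card ?J / (real (card ?J) - 1))) = (\<Sum>t\<in>S. L t)"
    using m by (simp add: sum_cube_insert[OF assms(4)] L_def fs_def add_divide_distrib add.commute)
  \<comment> \<open>The face of \<open>k\<close> gives the factor \<open>G\<close>; every other face
    sum splits over the slices.\<close>
  have rhs: "(\<Prod>i\<in>?J. face_sum S ?J i f) powr (1 / (real (card ?J) - 1))
      = G powr (1 / m) * (\<Prod>i\<in>I. \<Sum>t\<in>S. face_sum S I i (fs t)) powr (1 / m)"
  proof -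
    have "(\<Prod>i\<in>I. face_sum S ?J i f) = (\<Prod>i\<in>I. \<Sum>t\<in>S. face_sum S I i (fs t))"
      unfolding fs_def by (intro prod.cong refl face_sum_slice assms)
    then show ?thesis
      using assms(2,4) m by (simp add: G powr_mult)
  qed
  have LMw: "fs t w powr (1 + 1 / m) \<le> g w powr (1 / m) * fs t w" if "w \<in> cube S I" for t w
  proof -
    have "fs t w powr (1 / m) * fs t w \<le> g w powr (1 / m) * fs t w"
      using le[OF that] fs0[OF that] by (intro mult_right_mono powr_mono2) auto
    then show ?thesis using fs0[OF that] by (simp add: powr_add mult.commute)
  qed
  have LM: "L t \<le> M t" for t
    unfolding L_def M_def by (rule sum_mono) (rule LMw)
  have MR: "M t \<le> R t" for t
    using Q nn g0 unfolding weighted_max_ineq_def M_def R_def G_def m_def by blast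
  have "(\<Sum>t\<in>S. R t) = G powr (1 / m) * (\<Sum>t\<in>S. (\<Prod>i\<in>I. face_sum S I i (fs t)) powr (1 / m))"
    by (simp add: R_def sum_distrib_left)
  also have "\<dots> \<le> G powr (1 / m) * (\<Prod>i\<in>I. \<Sum>t\<in>S. face_sum S I i (fs t)) powr (1 / m)"
    unfolding m_def using assms face_sum_nonneg[OF assms(1) nn]
    by (intro mult_left_mono Holder_sum_prod) auto
  finally have RT: "(\<Sum>t\<in>S. R t)
      \<le> G powr (1 / m) * (\<Prod>i\<in>I. \<Sum>t\<in>S. face_sum S I i (fs t)) powr (1 / m)" .
  have LR: "(\<Sum>t\<in>S. L t) \<le> (\<Sum>t\<in>S. R t)"
    by (rule sum_mono) (rule order_trans[OF LM MR])
  show "(\<Sum>z\<in>cube S ?J. f z powr (card ?J / (real (card ?J) - 1)))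
       \<le> (\<Prod>i\<in>?J. face_sum S ?J i f) powr (1 / (real (card ?J) - 1)) \<and>
     ((\<Sum>z\<in>cube S ?J. f z powr (card ?J / (real (card ?J) - 1)))
       = (\<Prod>i\<in>?J. face_sum S ?J i f) powr (1 / (real (card ?J) - 1)) \<longrightarrow> box_function S ?J f)"
    unfolding lhs rhs
  proof (intro conjI impI)
    show "(\<Sum>t\<in>S. L t) \<le> G powr (1 / m) * (\<Prod>i\<in>I. \<Sum>t\<in>S. face_sum S I i (fs t)) powr (1 / m)"
      using LR RT by simp
    assume "(\<Sum>t\<in>S. L t) = G powr (1 / m) * (\<Prod>i\<in>I. \<Sum>t\<in>S. face_sum S I i (fs t)) powr (1 / m)"
    \<comment> \<open>The sum of \<open>R t\<close> lies between the two equal ends. Since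
      \<open>L t \<le> R t\<close> for each \<open>t\<close>, equality then holds slice by
      slice.\<close>
    then have eq: "(\<Sum>t\<in>S. L t) = (\<Sum>t\<in>S. R t)" using LR RT by simp
    have LRt: "L t = R t" if "t \<in> S" for t
      by (rule sum_mono_inv[OF eq order_trans[OF LM MR] that assms(1)])
    have eqLM: "L t = M t" and eqMR: "M t = R t" if "t \<in> S" for t
      using LRt[OF that] LM[of t] MR[of t] by auto
    \<comment> \<open>Equality in the pointwise bound: cancel the positive factor
      \<open>fs t w\<close> and use strict monotonicity of the power.\<close>
    have fg: "fs t w = g w" if "t \<in> S" "w \<in> cube S I" "0 < fs t w" for t w
    proof -
      have "fs t w powr (1 + 1 / m) = g w powr (1 / m) * fs t w"
        by (rule sum_mono_inv[OF eqLM[OF that(1), unfolded L_def M_def] LMw that(2)])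
          (use assms in \<open>auto intro: finite_cube\<close>)
      then have "fs t w powr (1 / m) = g w powr (1 / m)"
        using that(3) by (simp add: powr_add mult.commute)
      then have "\<not> fs t w < g w"
        using powr_less_mono2[of "1 / m" "fs t w" "g w"] m that(3) by auto
      with le[OF that(2), of t] show ?thesis by simp
    qed
    have Qeq: "(\<forall>w\<in>cube S I. fs t w = 0) \<or>
        box_function S I (fs t) \<and> (\<forall>w\<in>cube S I. fs t w = 0 \<longrightarrow> g w = 0)" if "t \<in> S" for t
      using Q nn g0 eqMR[OF that] unfolding weighted_max_ineq_def M_def R_def G_def m_def by blast
    \<comment> \<open>The positions of the nonzero slices; \<open>T\<close> becomes the factor of
      the box in direction \<open>k\<close>.\<close>
    define T where "T = {t\<in>S. \<exists>w\<in>cube S I. fs t w \<noteq> 0}"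
    have cube_J: "\<exists>t\<in>S. \<exists>w\<in>cube S I. z = w(k := t) \<and> f z = fs t w \<and> z k = t" if "z \<in> cube S ?J" for z
      using that unfolding cube_def PiE_insert_eq fs_def by fastforce
    show "box_function S ?J f"
    proof (cases "T = {}")
      case True
      then have "f z = 0" if "z \<in> cube S ?J" for z
        using cube_J[OF that] unfolding T_def by auto
      then have "\<forall>z\<in>cube S ?J. f z = 1 * indicator (Pi\<^sub>E ?J (\<lambda>_. {})) z"
        by (auto simp: PiE_iff indicator_def)
      then show ?thesis unfolding box_function_def by (meson zero_less_one)
    next
      case False
      then obtain s where s: "s \<in> T" by blast
      \<comment> \<open>Both slices equal \<open>g\<close>: by \<open>fg\<close> where they are
        positive, and by \<open>Qeq\<close> where they vanish, since there \<open>g\<close> vanishes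
        too.\<close>
      have eq_s: "fs t w = fs s w" if "t \<in> T" "w \<in> cube S I" for t w
      proof -
        have tS: "t \<in> S" "s \<in> S" using that s by (auto simp: T_def)
        have "fs t w = 0 \<Longrightarrow> g w = 0" "fs s w = 0 \<Longrightarrow> g w = 0"
          using Qeq[OF tS(1)] Qeq[OF tS(2)] that s unfolding T_def by auto
        then show ?thesis
          using fg[OF tS(1) that(2)] fg[OF tS(2) that(2)] fs0[OF that(2), of t] fs0[OF that(2), of s]
            le[OF that(2), of t] le[OF that(2), of s] by linarith
      qed
      obtain c X where c: "0 < c" and X: "\<forall>w\<in>cube S I. fs s w = c * indicator (Pi\<^sub>E I X) w"
        using Qeq[of s] s unfolding T_def box_function_def by blast
      have "f z = c * indicator (Pi\<^sub>E ?J (X(k := T))) z" if z: "z \<in> cube S ?J" for z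
      proof -
        obtain t w where tw: "t \<in> S" "w \<in> cube S I" "z = w(k := t)" "f z = fs t w"
          using cube_J[OF z] by blast
        have "z \<in> Pi\<^sub>E ?J (X(k := T)) \<longleftrightarrow> t \<in> T \<and> w \<in> Pi\<^sub>E I X"
          using tw(2,3) assms(4) by (auto simp: PiE_iff cube_def extensional_def)
        moreover have "fs t w = 0" if "t \<notin> T"
          using that tw(1,2) by (auto simp: T_def)
        moreover have "fs t w = c * indicator (Pi\<^sub>E I X) w" if "t \<in> T"
          using eq_s[OF that tw(2)] X tw(2) by simp
        ultimately show ?thesis
          unfolding tw(4) by (cases "t \<in> T"; cases "w \<in> Pi\<^sub>E I X") (simp_all add: indicator_def)
      qed
      then show ?thesis using c unfolding box_function_def by blast
    qed
  qed
qed

text \<open>Apply Hoelder with exponents 1/n and 1 - 1/n to \<open>g\<close> and f^(n/(n-1)), then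
  bound \<open>F\<close> by \<open>max_ineq\<close>.\<close>

lemma weighted_max_ineq_of_max_ineq:
  assumes "finite S" "finite I" "2 \<le> card I" and P: "max_ineq S I"
  shows "weighted_max_ineq S I"
  unfolding weighted_max_ineq_def
proof (intro allI impI)
  fix f g :: "(nat \<Rightarrow> int) \<Rightarrow> real"
  assume f: "nonneg_in_cube S I f"
    and g: "\<forall>z\<in>cube S I. 0 \<le> g z \<and> (0 < f z \<longrightarrow> 0 < g z)"
  define n where "n = real (card I)"
  have n: "2 \<le> n" using assms(3) by (simp add: n_def)
  \<comment> \<open>Hoelder is applied on the support of \<open>f\<close> only. This gives
    \<open>sum g B\<close> in place of \<open>G\<close>, and their equality says that
    \<open>g\<close> vanishes off the support.\<close>
  define B where "B = {z\<in>cube S I. f z \<noteq> 0}"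
  define F where "F = (\<Sum>z\<in>cube S I. f z powr (n / (n - 1)))"
  define N where "N = (\<Prod>i\<in>I. face_sum S I i f)"
  define G where "G = sum g (cube S I)"
  have fin: "finite (cube S I)" using assms by (simp add: finite_cube)
  have B: "B \<subseteq> cube S I" "finite B" using fin by (auto simp: B_def)
  have f0: "0 \<le> f z" if "z \<in> cube S I" for z
    using f that cube_subset_lattice by (auto simp: nonneg_in_cube_def)
  have N0: "0 \<le> N" unfolding N_def by (intro prod_nonneg ballI face_sum_nonneg[OF assms(1) f])
  have F0: "0 \<le> F" unfolding F_def by (intro sum_nonneg) auto
  have GB: "sum g B \<le> G" "0 \<le> sum g B"
    unfolding G_def using B fin g by (auto intro!: sum_mono2 sum_nonneg)
  have FB: "(\<Sum>z\<in>B. f z powr (n / (n - 1))) = F"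
    unfolding F_def B_def using fin by (intro sum.mono_neutral_left) auto
  have PF: "F \<le> N powr (1 / (n - 1))" "F = N powr (1 / (n - 1)) \<Longrightarrow> box_function S I f"
    using P f unfolding max_ineq_def F_def N_def n_def by blast+
  have "(\<Sum>z\<in>cube S I. g z powr (1 / n) * f z) = (\<Sum>z\<in>B. g z powr (1 / n) * f z)"
    unfolding B_def using fin by (intro sum.mono_neutral_right) auto
  also have "\<dots> = (\<Sum>z\<in>B. g z powr (1 / n) * (f z powr (n / (n - 1))) powr (1 - 1 / n))"
  proof (intro sum.cong refl)
    fix z assume "z \<in> B"
    then have "0 < f z" using f0[of z] by (auto simp: B_def)
    moreover have e: "n / (n - 1) * (1 - 1 / n) = 1" using n by (simp add: field_simps)
    ultimately show "g z powr (1 / n) * f z = g z powr (1 / n) * (f z powr (n / (n - 1))) powr (1 - 1 / n)"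
      by (simp only: powr_powr e) simp
  qed
  also have "\<dots> \<le> sum g B powr (1 / n) * F powr (1 - 1 / n)"
    unfolding FB[symmetric] using B g n by (intro Holder_sum2) auto
  finally have H: "(\<Sum>z\<in>cube S I. g z powr (1 / n) * f z) \<le> sum g B powr (1 / n) * F powr (1 - 1 / n)" .
  have H1: "sum g B powr (1 / n) * F powr (1 - 1 / n) \<le> G powr (1 / n) * F powr (1 - 1 / n)"
    using GB n by (intro mult_right_mono powr_mono2) auto
  have NN: "(N powr (1 / (n - 1))) powr (1 - 1 / n) = N powr (1 / n)"
  proof -
    have "1 / (n - 1) * (1 - 1 / n) = 1 / n" using n by (simp add: field_simps)
    then show ?thesis by (simp only: powr_powr)
  qed
  have "F powr (1 - 1 / n) \<le> N powr (1 / n)"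
    unfolding NN[symmetric] using PF(1) F0 n by (intro powr_mono2) auto
  then have H2: "G powr (1 / n) * F powr (1 - 1 / n) \<le> G powr (1 / n) * N powr (1 / n)"
    by (intro mult_left_mono) auto
  show "(\<Sum>z\<in>cube S I. g z powr (1 / card I) * f z)
       \<le> sum g (cube S I) powr (1 / card I) * (\<Prod>i\<in>I. face_sum S I i f) powr (1 / card I) \<and>
     ((\<Sum>z\<in>cube S I. g z powr (1 / card I) * f z)
       = sum g (cube S I) powr (1 / card I) * (\<Prod>i\<in>I. face_sum S I i f) powr (1 / card I) \<longrightarrow>
       (\<forall>z\<in>cube S I. f z = 0) \<or>
       box_function S I f \<and> (\<forall>z\<in>cube S I. f z = 0 \<longrightarrow> g z = 0))"
    unfolding n_def[symmetric] G_def[symmetric] N_def[symmetric]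
  proof (intro conjI impI)
    show "(\<Sum>z\<in>cube S I. g z powr (1 / n) * f z) \<le> G powr (1 / n) * N powr (1 / n)"
      using H H1 H2 by linarith
    assume "(\<Sum>z\<in>cube S I. g z powr (1 / n) * f z) = G powr (1 / n) * N powr (1 / n)"
    \<comment> \<open>Equality at the ends makes every link of the chain an equality. Below,
      \<open>e1\<close> yields \<open>sum g B = G\<close> and \<open>e2\<close> yields equality in
      \<open>max_ineq\<close>.\<close>
    then have e1: "sum g B powr (1 / n) * F powr (1 - 1 / n) = G powr (1 / n) * F powr (1 - 1 / n)"
      and e2: "G powr (1 / n) * F powr (1 - 1 / n) = G powr (1 / n) * N powr (1 / n)"
      using H H1 H2 by linarith+
    show "(\<forall>z\<in>cube S I. f z = 0) \<or>
       box_function S I f \<and> (\<forall>z\<in>cube S I. f z = 0 \<longrightarrow> g z = 0)"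
    proof (cases "B = {}")
      case True
      then show ?thesis by (auto simp: B_def)
    next
      case False
      have pos: "0 < f z" "0 < g z" if "z \<in> B" for z
        using that f0[of z] g by (auto simp: B_def less_le)
      have "0 < (\<Sum>z\<in>B. f z powr (n / (n - 1)))"
        using False B(2) by (intro sum_pos) (auto simp: B_def)
      \<comment> \<open>Positivity of \<open>F\<close> and \<open>G\<close> allows these common
        factors to be cancelled from \<open>e1\<close> and \<open>e2\<close>.\<close>
      then have F: "0 < F" by (simp add: FB)
      have "0 < sum g B" using False B pos by (intro sum_pos) auto
      then have G: "0 < G" using GB by simp
      have "sum g B powr (1 / n) = G powr (1 / n)" using e1 F by simp
      then have "sum g B = G"
        using powr_less_mono2[of "1 / n" "sum g B" G] GB n by force
      then have "sum g (cube S I - B) = 0"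
        using B fin by (simp add: G_def sum_diff)
      then have "\<forall>z\<in>cube S I - B. g z = 0"
        using fin g by (subst (asm) sum_nonneg_eq_0_iff) auto
      moreover have "F powr (1 - 1 / n) = (N powr (1 / (n - 1))) powr (1 - 1 / n)"
        using e2 G unfolding NN by simp
      then have "F = N powr (1 / (n - 1))"
        using powr_less_mono2[of "1 - 1 / n" F "N powr (1 / (n - 1))"] PF(1) F0 n by force
      ultimately show ?thesis using PF(2) by (auto simp: B_def)
    qed
  qed
qed

text \<open>The two statements alternate: the weighted one for \<open>I\<close> gives
  \<open>max_ineq\<close> for \<open>insert k I\<close>, which in turn gives the weighted one
  there.\<close>

lemma weighted_max_ineq:
  assumes "finite S" "finite I" "I \<noteq> {}"
  shows "weighted_max_ineq S I"
  using assms(2,3)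
proof (induction I rule: finite_ne_induct)
  case (singleton j)
  show ?case by (rule weighted_max_ineq_singleton[OF assms(1)])
next
  case (insert k I)
  have "card I \<noteq> 0" "card (insert k I) = Suc (card I)"
    using insert.hyps by simp_all
  then have "2 \<le> card (insert k I)" by linarith
  moreover have "max_ineq S (insert k I)"
    using insert assms(1) by (intro max_ineq_insert)
  ultimately show ?case
    using insert.hyps assms(1) by (intro weighted_max_ineq_of_max_ineq) simp_all
qed

lemma max_ineq:
  assumes "finite S" "finite I" "2 \<le> card I"
  shows "max_ineq S I"
proof -
  obtain k J where I: "I = insert k J" "k \<notin> J"
    using assms(3) by (metis card.empty equals0I mk_disjoint_insert not_numeral_le_zero)
  then have "finite J" "J \<noteq> {}" using assms(2,3) by auto
  then show ?thesis
    unfolding I(1) using assms(1) I(2) by (intro max_ineq_insert weighted_max_ineq)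
qed

section \<open>Boxes attain equality\<close>

text \<open>Both sides equal \<open>c powr p * V\<close>, where \<open>V\<close> is the number of
  points of the box: each face sum is \<open>c * V / card (X i)\<close>, so their product is c^n *
  V^(n-1).\<close>

lemma box_equality:
  assumes "finite S" "finite I" "2 \<le> card I" and f: "nonneg_in_cube S I f"
    and c: "0 < c" and X: "\<And>i. i \<in> I \<Longrightarrow> X i \<noteq> {} \<and> X i \<subseteq> S"
    and fX: "\<And>z. z \<in> lattice I \<Longrightarrow> f z = c * indicator (Pi\<^sub>E I X) z"
  shows "(\<Sum>z\<in>cube S I. f z powr (card I / (real (card I) - 1)))
    = (\<Prod>i\<in>I. face_sum S I i f) powr (1 / (real (card I) - 1))"
proof -
  define n where "n = card I"
  define p where "p = n / (real n - 1)"
  define V where "V = (\<Prod>i\<in>I. real (card (X i)))"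
  have n: "2 \<le> n" using assms(3) by (simp add: n_def)
  have cX: "0 < card (X i)" if "i \<in> I" for i
    using X[OF that] assms(1) by (auto simp: card_gt_0_iff intro: finite_subset)
  then have V: "0 < V" unfolding V_def by (intro prod_pos) auto
  \<comment> \<open>Stated for all \<open>J\<close>, to serve the full box and its faces
    alike.\<close>
  have sum_box: "(\<Sum>z\<in>cube S J. a * indicator (Pi\<^sub>E J X) z) = a * (\<Prod>i\<in>J. real (card (X i)))"
    if "J \<subseteq> I" for J and a :: real
  proof -
    have J: "finite J" using that assms(2) by (rule finite_subset)
    have "Pi\<^sub>E J X \<subseteq> cube S J"
      using X that by (auto simp: cube_def PiE_iff)
    then have "(\<Sum>z\<in>cube S J. a * indicator (Pi\<^sub>E J X) z) = (\<Sum>z\<in>Pi\<^sub>E J X. a)"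
      using J assms(1) by (intro sum.mono_neutral_cong_right) (auto simp: finite_cube)
    then show ?thesis using J by (simp add: card_PiE)
  qed
  have "(\<Sum>z\<in>cube S I. f z powr p) = (\<Sum>z\<in>cube S I. c powr p * indicator (Pi\<^sub>E I X) z)"
  proof (intro sum.cong refl)
    fix z assume "z \<in> cube S I"
    then have "f z = c * indicator (Pi\<^sub>E I X) z"
      using fX cube_subset_lattice by blast
    then show "f z powr p = c powr p * indicator (Pi\<^sub>E I X) z"
      by (simp add: indicator_def)
  qed
  also have "\<dots> = c powr p * V"
    unfolding V_def by (rule sum_box) simp
  finally have lhs: "(\<Sum>z\<in>cube S I. f z powr p) = c powr p * V" .
  \<comment> \<open>As \<open>X i\<close> is nonempty, the fibre over \<open>w\<close> meets the box
    exactly when \<open>w\<close> lies in its projection.\<close>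
  have fm: "fibre_max i f w = c * indicator (Pi\<^sub>E (I - {i}) X) w"
    if i: "i \<in> I" and w: "w \<in> lattice (I - {i})" for i w
  proof -
    have upd: "f (w(i := t)) = (if t \<in> X i \<and> w \<in> Pi\<^sub>E (I - {i}) X then c else 0)" for t
      using fX[OF upd_in_lattice[OF i w], of t] i w
      by (auto simp: indicator_def PiE_iff lattice_def extensional_def)
    obtain t where "t \<in> X i" using X[OF i] by blast
    then have "c * indicator (Pi\<^sub>E (I - {i}) X) w \<le> fibre_max i f w"
      using fibre_max_ge[OF assms(1) f i w, of t] by (simp add: upd indicator_def split: if_splits)
    moreover obtain s where "fibre_max i f w = f (w(i := s))"
      using fibre_max_attained[OF assms(1) f i w] .
    ultimately show ?thesis
      using c by (auto simp: upd indicator_def split: if_splits)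
  qed
  have face: "face_sum S I i f = c * V / card (X i)" if i: "i \<in> I" for i
  proof -
    have "face_sum S I i f = (\<Sum>w\<in>cube S (I - {i}). c * indicator (Pi\<^sub>E (I - {i}) X) w)"
      unfolding face_sum_def using fm[OF i] cube_subset_lattice by (intro sum.cong) auto
    also have "\<dots> = c * (\<Prod>j\<in>I - {i}. real (card (X j)))"
      by (rule sum_box) auto
    finally show ?thesis
      using prod.remove[OF assms(2) i, of "\<lambda>j. real (card (X j))"] cX[OF i] by (simp add: V_def)
  qed
  have "(\<Prod>i\<in>I. face_sum S I i f) = (\<Prod>i\<in>I. c * V / card (X i))"
    by (intro prod.cong) (simp_all add: face)
  also have "\<dots> = (c * V) ^ n / V"
    by (simp add: prod_dividef n_def V_def)
  also have "\<dots> = c powr n * V powr (real n - 1)"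
    using c V by (simp add: powr_realpow power_mult_distrib powr_diff)
  finally have "(\<Prod>i\<in>I. face_sum S I i f) powr (1 / (real n - 1))
      = (c powr n) powr (1 / (real n - 1)) * (V powr (real n - 1)) powr (1 / (real n - 1))"
    by (simp add: powr_mult)
  also have "\<dots> = c powr p * V"
    using V n by (simp add: powr_powr p_def)
  finally show ?thesis
    using lhs by (simp add: n_def p_def)
qed

section \<open>The inequality on the lattice\<close>

lemma powr_eq_iff_base:
  fixes x y a :: real
  assumes "0 < a" "0 \<le> x" "0 \<le> y"
  shows "x powr a = y powr a \<longleftrightarrow> x = y"
  using powr_less_mono2[OF assms(1,2)] powr_less_mono2[OF assms(1,3)]
  by (metis less_irrefl linorder_neqE_linordered_idom)

lemma C0_nonneg_in_cube:
  assumes "finite I" "f \<in> C0 (lattice I)" "\<forall>z\<in>lattice I. f z \<ge> 0"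
  obtains S where "finite S" "nonneg_in_cube S I f"
proof
  define D where "D = {z \<in> lattice I. f z \<noteq> 0}"
  \<comment> \<open>All coordinate values that occur in the support.\<close>
  define S where "S = (\<Union>i\<in>I. coord i ` D)"
  have "finite D" using assms(2) by (simp add: C0_def D_def)
  then show "finite S" using assms(1) by (simp add: S_def)
  have "D \<subseteq> cube S I"
    by (auto simp: S_def cube_def PiE_iff coord_def D_def lattice_def extensional_def)
  then show "nonneg_in_cube S I f"
    using assms(3) by (auto simp: nonneg_in_cube_def D_def)
qed

text \<open>Points off the cube contribute nothing, whatever \<open>p\<close> is, because
  \<open>0 powr p = 0\<close>.\<close>

lemma lp_norm_eq_sum_cube:
  assumes "finite S" "finite I" "nonneg_in_cube S I f"
  shows "lp_norm (lattice I) p f = (\<Sum>z\<in>cube S I. f z powr p) powr (1 / p)"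
proof -
  have "(\<Sum>\<^sub>\<infinity>z\<in>lattice I. \<bar>f z\<bar> powr p) = (\<Sum>\<^sub>\<infinity>z\<in>cube S I. f z powr p)"
    using assms(3) cube_subset_lattice[of S I]
    by (intro infsum_cong_neutral) (auto simp: nonneg_in_cube_def)
  then show ?thesis using assms(1,2) by (simp add: lp_norm_def finite_cube)
qed

lemma lp_norm_fibre_max:
  assumes "finite S" "finite I" "nonneg_in_cube S I f" "i \<in> I"
  shows "lp_norm (lattice (I - {i})) 1 (fibre_max i f) = face_sum S I i f"
proof -
  have "nonneg_in_cube S (I - {i}) (fibre_max i f)"
    unfolding nonneg_in_cube_def
    using fibre_max_nonneg[OF assms(1,3,4)] fibre_max_outside[OF assms(1,3,4)] by blast
  then have "lp_norm (lattice (I - {i})) 1 (fibre_max i f)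
      = (\<Sum>w\<in>cube S (I - {i}). fibre_max i f w powr 1) powr (1 / 1)"
    using assms(1,2) by (intro lp_norm_eq_sum_cube) auto
  also have "(\<Sum>w\<in>cube S (I - {i}). fibre_max i f w powr 1) = face_sum S I i f"
    unfolding face_sum_def using fibre_max_nonneg[OF assms(1,3,4)] cube_subset_lattice
    by (intro sum.cong) (auto simp: subset_iff)
  finally show ?thesis using face_sum_nonneg[OF assms(1,3,4)] by simp
qed

text \<open>Cutting the factors down to \<open>S\<close> puts the box inside the cube, off which
  \<open>f\<close> vanishes; a nonempty box has its factors as projections. Conversely, the
  projections of \<open>A\<close> serve as factors.\<close>

lemma box_function_iff:
  assumes "I \<noteq> {}" "nonneg_in_cube S I f"
  shows "box_function S I f \<longleftrightarrow> (\<exists>(c::real) A. c > 0 \<and> A \<subseteq> lattice I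
    \<and> A = (\<Pi>\<^sub>E i\<in>I. coord i ` A) \<and> (\<forall>z\<in>lattice I. f z = c * indicator A z))"
proof
  assume "box_function S I f"
  then obtain c X where c: "0 < c" and X: "\<forall>z\<in>cube S I. f z = c * indicator (Pi\<^sub>E I X) z"
    unfolding box_function_def by blast
  define A where "A = (\<Pi>\<^sub>E i\<in>I. X i \<inter> S)"
  have A: "A = Pi\<^sub>E I X \<inter> cube S I" by (auto simp: A_def cube_def PiE_iff)
  have "A = (\<Pi>\<^sub>E i\<in>I. coord i ` A)"
  proof (cases "A = {}")
    case True
    \<comment> \<open>A product of empty projections is empty because \<open>I\<close> is
      nonempty.\<close>
    then show ?thesis using assms(1) by (auto simp: PiE_eq_empty_iff)
  next
    case False
    have "coord i ` A = X i \<inter> S" if "i \<in> I" for i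
      using False that image_projection_PiE[of i I "\<lambda>i. X i \<inter> S"] by (simp add: A_def coord_def)
    then show ?thesis by (simp add: A_def cong: PiE_cong)
  qed
  moreover have "f z = c * indicator A z" if "z \<in> lattice I" for z
    using assms(2) X that by (cases "z \<in> cube S I") (auto simp: A nonneg_in_cube_def indicator_def)
  moreover have "A \<subseteq> lattice I" using A cube_subset_lattice by blast
  ultimately show "\<exists>(c::real) A. c > 0 \<and> A \<subseteq> lattice I
    \<and> A = (\<Pi>\<^sub>E i\<in>I. coord i ` A) \<and> (\<forall>z\<in>lattice I. f z = c * indicator A z)"
    using c by blast
next
  assume "\<exists>(c::real) A. c > 0 \<and> A \<subseteq> lattice I
    \<and> A = (\<Pi>\<^sub>E i\<in>I. coord i ` A) \<and> (\<forall>z\<in>lattice I. f z = c * indicator A z)"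
  then obtain c A where "c > 0" "A = (\<Pi>\<^sub>E i\<in>I. coord i ` A)"
    "\<forall>z\<in>lattice I. f z = c * indicator A z" by blast
  then show "box_function S I f"
    unfolding box_function_def using cube_subset_lattice by (metis subsetD)
qed

text \<open>For empty \<open>A\<close> both sides vanish. Otherwise the projections of
  \<open>A\<close> are nonempty and \<open>box_equality\<close> applies to them.\<close>

lemma box_function_equality:
  assumes "finite S" "finite I" "2 \<le> card I" and f: "nonneg_in_cube S I f"
    and "box_function S I f"
  shows "(\<Sum>z\<in>cube S I. f z powr (card I / (real (card I) - 1)))
    = (\<Prod>i\<in>I. face_sum S I i f) powr (1 / (real (card I) - 1))"
proof -
  have I: "I \<noteq> {}" using assms(3) by auto
  obtain c A where c: "c > 0" and A: "A \<subseteq> lattice I" "A = (\<Pi>\<^sub>E i\<in>I. coord i ` A)"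
    and fA: "\<forall>z\<in>lattice I. f z = c * indicator A z"
    using assms(5) unfolding box_function_iff[OF I f] by blast
  show ?thesis
  proof (cases "A = {}")
    case True
    have "face_sum S I i f = 0" if "i \<in> I" for i
      unfolding face_sum_def
    proof (rule sum.neutral, rule ballI)
      fix w assume "w \<in> cube S (I - {i})"
      then have w: "w \<in> lattice (I - {i})" using cube_subset_lattice by blast
      show "fibre_max i f w = 0"
        using fibre_max_attained[OF assms(1) f that w] fA True upd_in_lattice[OF that w]
        by (metis indicator_simps(2) empty_iff mult_zero_right)
    qed
    then have "(\<Prod>i\<in>I. face_sum S I i f) = 0" using I assms(2) by auto
    moreover have "(\<Sum>z\<in>cube S I. f z powr (card I / (real (card I) - 1))) = 0"
      using fA True cube_subset_lattice by (intro sum.neutral) auto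
    ultimately show ?thesis by simp
  next
    case False
    \<comment> \<open>On \<open>A\<close> the value of \<open>f\<close> is \<open>c > 0\<close>,
      while \<open>f\<close> vanishes off the cube.\<close>
    have "A \<subseteq> cube S I"
      using A(1) fA c f by (force simp: nonneg_in_cube_def)
    then have "coord i ` A \<noteq> {} \<and> coord i ` A \<subseteq> S" if "i \<in> I" for i
      using False that by (auto simp: cube_def coord_def)
    then show ?thesis
      using fA unfolding A(2)[symmetric]
      by (intro box_equality[OF assms(1-3) f c, of "\<lambda>i. coord i ` A"]) (simp_all flip: A(2))
  qed
qed

theorem theorem1p2:
  fixes n :: nat and f :: "(nat \<Rightarrow> int) \<Rightarrow> real"
  assumes "n \<ge> 2"
    and "f \<in> C0 (lattice {1..n})"
    and "\<forall>z\<in>lattice {1..n}. f z \<ge> 0"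
  shows "lp_norm (lattice {1..n}) (real n / (real n - 1)) f
           \<le> (\<Prod>i=1..n. lp_norm (lattice ({1..n} - {i})) 1 (fibre_max i f)) powr (1 / real n)
       \<and> (lp_norm (lattice {1..n}) (real n / (real n - 1)) f
           = (\<Prod>i=1..n. lp_norm (lattice ({1..n} - {i})) 1 (fibre_max i f)) powr (1 / real n)
         \<longleftrightarrow> (\<exists>(c::real) A. c > 0 \<and> A \<subseteq> lattice {1..n}
               \<and> A = (\<Pi>\<^sub>E i\<in>{1..n}. coord i ` A)
               \<and> (\<forall>z\<in>lattice {1..n}. f z = c * indicator A z)))"
proof -
  define I where "I = {1..n}"
  define N where "N = (\<Prod>i=1..n. lp_norm (lattice ({1..n} - {i})) 1 (fibre_max i f))"
  have I: "finite I" "card I = n" "I \<noteq> {}" using assms(1) by (auto simp: I_def)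
  obtain S where S: "finite S" "nonneg_in_cube S I f"
    using C0_nonneg_in_cube[of I f] assms(2,3) I(1) unfolding I_def by blast
  define p where "p = real n / (real n - 1)"
  define F where "F = (\<Sum>z\<in>cube S I. f z powr p)"
  have N: "N = (\<Prod>i\<in>I. face_sum S I i f)"
    unfolding N_def I_def[symmetric]
    using lp_norm_fibre_max[OF S(1) I(1) S(2)] by (intro prod.cong) auto
  have p: "0 < p" using assms(1) by (simp add: p_def)
  have norm: "lp_norm (lattice {1..n}) p f = F powr (1 / p)"
    unfolding F_def I_def[symmetric] by (rule lp_norm_eq_sum_cube[OF S(1) I(1) S(2)])
  \<comment> \<open>The theorem is the cube inequality raised to the power \<open>1 / p\<close>.
    This map is increasing and injective on nonnegative reals, so it carries over both the bound and
    the equality case.\<close>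
  have "1 / (real n - 1) * (1 / p) = 1 / real n"
    using assms(1) by (simp add: p_def)
  then have rhs: "N powr (1 / real n) = (N powr (1 / (real n - 1))) powr (1 / p)"
    by (simp only: powr_powr)
  have F0: "0 \<le> F" unfolding F_def by (intro sum_nonneg) auto
  have P: "F \<le> N powr (1 / (real n - 1))"
    "F = N powr (1 / (real n - 1)) \<Longrightarrow> box_function S I f"
    using max_ineq[OF S(1) I(1)] S(2) assms(1)
    unfolding max_ineq_def F_def N p_def I(2) by blast+
  have P': "box_function S I f \<Longrightarrow> F = N powr (1 / (real n - 1))"
    using box_function_equality[OF S(1) I(1) _ S(2)] assms(1)
    unfolding F_def N p_def I(2) by blast
  have "F powr (1 / p) \<le> N powr (1 / real n)"
    unfolding rhs using P(1) F0 p by (intro powr_mono2) auto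
  moreover have "F powr (1 / p) = N powr (1 / real n) \<longleftrightarrow> box_function S I f"
    unfolding rhs using P(2) P' F0 p by (subst powr_eq_iff_base) auto
  ultimately show ?thesis
    unfolding N_def[symmetric] p_def[symmetric] norm box_function_iff[OF I(3) S(2)]
    unfolding I_def by blast
qed

end
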